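(* $K_{1,3}$ is the only unweighted tree with no degree-two vertex that admits $\epsilon$-uniform mixing relative to the adjacency matrix.
   Context: Trees are finite; unweighted means all edges have weight $1$. $K_{1,3}$ is the star on four vertices. For a graph on $n$ vertices with adjacency matrix $A$, put $U(t)=e^{\mathrm{i}tA}$; $\mathbf{e}_u$ is the characteristic vector of $u$, $\mathbf{1}$ the all-ones vector, $\circ$ the entrywise product. $\epsilon$-uniform mixing occurs if for each $\epsilon>0$ there is a $\tau\in\mathbb{R}$ such that $\big\|(U(\tau)\mathbf{e}_u)\circ(\overline{U(\tau)}\mathbf{e}_u)-\tfrac1n\mathbf{1}\big\|<\epsilon$ simultaneously for all vertices $u$.
   Formalization: Only trees with at least three vertices are considered: the trees on one and two vertices have no degree-two vertex and also admit (even exact) uniform mixing, so the claim read over all trees is false for exactly these two. *)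

theory Defs
  imports "HOL-Analysis.Analysis" "Graph_Theory.Kuratowski"
begin

text \<open>
  A \<^locale>\<open>graph\<close> is a finite simple graph represented as a symmetric digraph, so that every edge
  \<open>uv\<close> also gives the closed walk \<open>u, v, u\<close>, which \<^const>\<open>pre_digraph.cycle\<close> accepts. Hence
  \<^const>\<open>Digraph_Component.tree\<close> does not describe undirected trees; the cycles of the underlying
  undirected graph are exactly the cycles of length at least three.
\<close>

definition undirected_tree :: "('v, 'e) pre_digraph \<Rightarrow> bool" where
  "undirected_tree G \<longleftrightarrow>
     graph G \<and> Digraph_Component.connected G \<and>
     \<not> (\<exists>p. pre_digraph.cycle G p \<and> 3 \<le> length p)"

definition adjacency_matrix :: "('v::finite, 'e) pre_digraph \<Rightarrow> complex^'v^'v" where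
  "adjacency_matrix G = (\<chi> u v. if u \<rightarrow>\<^bsub>G\<^esub> v then 1 else 0)"

text \<open>
  The type class operations \<open>*\<close>, \<open>^\<close> and \<open>1\<close> on \<open>complex^'n\<close> and \<open>complex^'n^'n\<close> act entrywise;
  matrix powers therefore have to be taken with respect to \<open>**\<close> and \<open>mat 1\<close>.
\<close>

primrec matrix_power :: "complex^'n^'n \<Rightarrow> nat \<Rightarrow> complex^'n^'n" where
  "matrix_power M 0 = mat 1"
| "matrix_power M (Suc k) = M ** matrix_power M k"

definition matrix_exp :: "complex^'n^'n \<Rightarrow> complex^'n^'n" where
  "matrix_exp M = (\<Sum>k. (1 / fact k) *\<^sub>R matrix_power M k)"

definition transition_matrix :: "complex^'n^'n \<Rightarrow> real \<Rightarrow> complex^'n^'n" where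
  "transition_matrix A t = matrix_exp (\<chi> u v. \<i> * of_real t * A $ u $ v)"

definition conj_matrix :: "complex^'n^'m \<Rightarrow> complex^'n^'m" where
  "conj_matrix M = (\<chi> u v. cnj (M $ u $ v))"

text \<open>
  Below, \<open>axis u 1\<close> is the characteristic vector of \<open>u\<close>, \<open>*\<close> between vectors is the entrywise
  product, \<open>1\<close> is the all-ones vector, and the norm is the Euclidean one.
\<close>

definition eps_uniform_mixing :: "complex^'n^'n \<Rightarrow> bool" where
  "eps_uniform_mixing A \<longleftrightarrow>
     (\<forall>\<epsilon>>0. \<exists>\<tau>. \<forall>u.
        norm ((transition_matrix A \<tau> *v axis u 1) * (conj_matrix (transition_matrix A \<tau>) *v axis u 1)
              - (1 / real CARD('n)) *\<^sub>R 1) < \<epsilon>)"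

end

theory Submission
  imports Defs "Graph_Theory.Vertex_Walk"
begin

text \<open>Trees and mixing meet in a pair of twin leaves. In a tree with at least three vertices
  and none of degree two, an end of a longest path is a leaf, its neighbour \<open>c\<close> has
  degree at least three, and a second leaf hangs at \<open>c\<close>
  (\<open>tree_twin_leaves\<close>). The difference of the characteristic vectors of the two leaves
  lies in the kernel of the adjacency matrix, so U(t) fixes it for every t. This forces some entry
  of U(t) to have modulus at least 1/2, whereas mixing brings all moduli close to 1/sqrt n; hence n
  \<le> 4 (\<open>eps_uniform_mixing_twins_card_le_4\<close>). As \<open>c\<close> and three of its
  neighbours already make four vertices, the tree is the star.

  Conversely, the spectral decomposition of the star is explicit, and at one suitable time all
  entries of U(t) have modulus exactly 1/2 (\<open>star_eps_uniform_mixing\<close>). Both directions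
  know U(t) only through its action on eigenvectors of the adjacency matrix
  (\<open>transition_matrix_eigenvector\<close>).\<close>

unbundle no funcset_syntax

section \<open>The matrix exponential on eigenvectors\<close>

text \<open>An entry of a matrix product is a sum of n products, so each further factor
  \<open>M\<close> costs at most n times \<open>B\<close>.\<close>

lemma norm_matrix_power_nth_le:
  fixes M :: "complex^'n^'n"
  assumes "\<And>u v. norm (M $ u $ v) \<le> B"
  shows "norm (matrix_power M k $ u $ v) \<le> (real CARD('n) * B) ^ k"
proof (induction k arbitrary: u v)
  case 0
  show ?case by (simp add: mat_def)
next
  case (Suc k)
  have "norm (matrix_power M (Suc k) $ u $ v) \<le> (\<Sum>w\<in>UNIV. norm (M $ u $ w * matrix_power M k $ w $ v))"
    by (simp add: matrix_matrix_mult_def norm_sum)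
  also have "\<dots> \<le> (\<Sum>w\<in>(UNIV::'n set). B * (real CARD('n) * B) ^ k)"
    unfolding norm_mult
    by (intro sum_mono mult_mono assms Suc.IH order_trans[OF norm_ge_zero assms] norm_ge_zero)
  finally show ?case by simp
qed

lemma norm_matrix_le_sum:
  fixes N :: "complex^'n^'m"
  shows "norm N \<le> (\<Sum>u\<in>UNIV. \<Sum>v\<in>UNIV. norm (N $ u $ v))"
proof -
  have "norm N \<le> (\<Sum>u\<in>UNIV. norm (N $ u))"
    by (simp add: norm_vec_def L2_set_le_sum)
  also have "\<dots> \<le> (\<Sum>u\<in>UNIV. \<Sum>v\<in>UNIV. norm (N $ u $ v))"
    by (rule sum_mono) (simp add: norm_vec_def L2_set_le_sum)
  finally show ?thesis .
qed

text \<open>Without convergence the infinite sum in \<open>matrix_exp\<close> would carry no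
  information. The comparison series is that of exp(n B); the two extra factors n come from summing
  over all entries.\<close>

lemma summable_matrix_exp:
  fixes M :: "complex^'n^'n"
  shows "summable (\<lambda>k. (1 / fact k) *\<^sub>R matrix_power M k)"
proof -
  define B where "B = norm M"
  have "norm (M $ u $ v) \<le> B" for u v
    unfolding B_def by (meson Finite_Cartesian_Product.norm_nth_le order_trans)
  note power_le = norm_matrix_power_nth_le[OF this]
  let ?n = "real CARD('n)"
  have "summable (\<lambda>k. ?n * (?n * ((?n * B) ^ k / fact k)))"
    using summable_exp[of "?n * B"] by (intro summable_mult) (simp add: field_simps)
  moreover have "norm ((1 / fact k) *\<^sub>R matrix_power M k) \<le> ?n * (?n * ((?n * B) ^ k / fact k))" for k
  proof -
    have "norm (matrix_power M k) \<le> (\<Sum>u\<in>(UNIV::'n set). \<Sum>v\<in>(UNIV::'n set). (?n * B) ^ k)"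
      by (rule order_trans[OF norm_matrix_le_sum]) (intro sum_mono power_le)
    then show ?thesis by (simp add: field_simps)
  qed
  ultimately show ?thesis
    by (rule summable_comparison_test')
qed

lemma matrix_power_eigenvector:
  assumes "M *v x = c *s x"
  shows "matrix_power M k *v x = c ^ k *s x"
proof (induction k)
  case (Suc k)
  have "matrix_power M (Suc k) *v x = M *v (matrix_power M k *v x)"
    by (simp add: matrix_vector_mul_assoc)
  then show ?case
    by (simp add: Suc.IH vector_scalar_commute assms mult.commute)
qed simp

text \<open>Evaluation of a matrix at the fixed vector \<open>x\<close> is bounded linear, so it
  passes through the series and leaves the scalar exponential series of \<open>c\<close>.\<close>

lemma matrix_exp_eigenvector:
  fixes M :: "complex^'n^'n"
  assumes "M *v x = c *s x"
  shows "matrix_exp M *v x = exp c *s x"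
proof -
  have "bounded_linear (\<lambda>N :: complex^'n^'n. N *v x)"
    unfolding linear_conv_bounded_linear[symmetric]
    by (rule linearI) (simp_all add: vec_eq_iff matrix_vector_mult_def sum.distrib scaleR_sum_right distrib_right)
  from bounded_linear.sums[OF this summable_sums[OF summable_matrix_exp[of M]]]
  have 1: "(\<lambda>k. ((1 / fact k) *\<^sub>R matrix_power M k) *v x) sums (matrix_exp M *v x)"
    by (simp add: matrix_exp_def)
  have 2: "((1 / fact k) *\<^sub>R matrix_power M k) *v x = (c ^ k /\<^sub>R fact k) *s x" for k
  proof -
    have "((1 / fact k) *\<^sub>R matrix_power M k) *v x = (1 / fact k) *\<^sub>R (matrix_power M k *v x)"
      by (simp add: vec_eq_iff matrix_vector_mult_def scaleR_sum_right)
    also have "\<dots> = (c ^ k /\<^sub>R fact k) *s x"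
      by (simp add: matrix_power_eigenvector[OF assms] vec_eq_iff inverse_eq_divide)
    finally show ?thesis .
  qed
  have "bounded_linear (\<lambda>z. z *s x)"
    unfolding linear_conv_bounded_linear[symmetric]
    by (rule linearI) (simp_all add: vec_eq_iff distrib_right)
  from bounded_linear.sums[OF this exp_converges[of c]]
  have "(\<lambda>k. (c ^ k /\<^sub>R fact k) *s x) sums (exp c *s x)" .
  with 1 show ?thesis unfolding 2 by (rule sums_unique2)
qed

lemma transition_matrix_eigenvector:
  assumes "A *v x = c *s x"
  shows "transition_matrix A t *v x = exp (\<i> * of_real t * c) *s x"
  unfolding transition_matrix_def
proof (rule matrix_exp_eigenvector)
  have "(\<chi> u v. \<i> * of_real t * A $ u $ v) *v x = (\<i> * of_real t) *s (A *v x)"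
    by (simp add: vec_eq_iff matrix_vector_mult_def sum_distrib_left mult.assoc)
  then show "(\<chi> u v. \<i> * of_real t * A $ u $ v) *v x = (\<i> * of_real t * c) *s x"
    by (simp add: assms)
qed

section \<open>Uniform mixing\<close>

lemma matrix_vector_mult_axis:
  fixes M :: "complex^'n^'m"
  shows "M *v axis u 1 = column u M"
  by (simp add: vec_eq_iff matrix_vector_mult_def column_def axis_def if_distrib cong: if_cong)

text \<open>Applying U to a characteristic vector picks a column, and an entry times its conjugate
  is a squared modulus. Mixing thus becomes a condition on the moduli of the entries of U.\<close>

lemma mixing_entry:
  fixes U :: "complex^'n^'n"
  shows "((U *v axis u 1) * (conj_matrix U *v axis u 1) - (1 / real CARD('n)) *\<^sub>R 1) $ v
    = of_real ((norm (U $ v $ u))\<^sup>2 - 1 / real CARD('n))"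
  unfolding of_real_diff complex_norm_square
  by (simp only: vector_minus_component vector_mult_component vector_scaleR_component one_index
      of_real_def matrix_vector_mult_axis column_def conj_matrix_def vec_lambda_beta)

text \<open>
  If \<open>u\<close> and \<open>v\<close> are twins, then \<open>axis u 1 - axis v 1\<close> is in the kernel of \<open>A\<close>, so it is fixed by
  every \<open>U(t)\<close>. Its \<open>u\<close>-th entry gives \<open>1 = U(t)\<^sub>u\<^sub>u - U(t)\<^sub>u\<^sub>v\<close>, while under uniform mixing both terms
  have modulus close to \<open>1 / sqrt n\<close>.
\<close>

lemma eps_uniform_mixing_twins_card_le_4:
  fixes A :: "complex^'n^'n"
  assumes mix: "eps_uniform_mixing A" and "u \<noteq> v" and twins: "\<And>w. A $ w $ u = A $ w $ v"
  shows "CARD('n) \<le> 4"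
proof (rule ccontr)
  assume "\<not> CARD('n) \<le> 4"
  then have n: "1 / real CARD('n) \<le> 1 / 5"
    by (simp add: field_simps)
  \<comment> \<open>The tolerance is 1/4 - 1/5: as 1/n \<le> 1/5, it keeps all squared moduli below
    1/4.\<close>
  have "(1/20::real) > 0" by simp
  with mix obtain \<tau> where \<tau>: "\<And>u. norm ((transition_matrix A \<tau> *v axis u 1) * (conj_matrix (transition_matrix A \<tau>) *v axis u 1)
              - (1 / real CARD('n)) *\<^sub>R 1) < 1/20"
    unfolding eps_uniform_mixing_def by blast
  define U where "U = transition_matrix A \<tau>"
  have entry: "(norm (U $ w $ w'))\<^sup>2 < 1/4" for w w'
  proof -
    have "norm (of_real ((norm (U $ w $ w'))\<^sup>2 - 1 / real CARD('n)) :: complex) < 1/20"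
      unfolding mixing_entry[symmetric]
      by (rule le_less_trans[OF Finite_Cartesian_Product.norm_nth_le \<tau>[of w', folded U_def]])
    then have "(norm (U $ w $ w'))\<^sup>2 - 1 / real CARD('n) < 1/20"
      unfolding norm_of_real by linarith
    with n show ?thesis by linarith
  qed
  have small: "norm (U $ w $ w') < 1/2" for w w'
    by (rule power2_less_imp_less) (use entry in \<open>auto simp: power2_eq_square\<close>)
  have "A *v (axis u 1 - axis v 1) = 0 *s (axis u 1 - axis v 1)"
    by (simp add: matrix_vector_mult_diff_distrib matrix_vector_mult_axis column_def twins)
  from transition_matrix_eigenvector[OF this, of \<tau>]
  have "column u U - column v U = axis u 1 - axis v 1"
    by (simp add: U_def matrix_vector_mult_diff_distrib matrix_vector_mult_axis)
  then have "U $ u $ u - U $ u $ v = 1"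
    using \<open>u \<noteq> v\<close> by (auto simp: vec_eq_iff column_def axis_def dest: spec[of _ u])
  then have "1 \<le> norm (U $ u $ u) + norm (U $ u $ v)"
    by (metis norm_one norm_triangle_ineq4)
  with small[of u u] small[of u v] show False by linarith
qed

text \<open>
  The star has eigenvalues \<open>0\<close> and \<open>\<plusminus>sqrt 3\<close>; at the time \<open>\<tau>\<close> with \<open>sqrt 3 * \<tau> = 2 * pi / 3\<close> every entry
  of \<open>U(\<tau>)\<close> has modulus exactly \<open>1/2\<close>.
\<close>

lemma star_eps_uniform_mixing:
  fixes A :: "complex^'n^'n"
  assumes card: "CARD('n) = 4"
    and A: "\<And>u v. A $ u $ v = (if (u = c) \<noteq> (v = c) then 1 else 0)"
  shows "eps_uniform_mixing A"
proof -
  \<comment> \<open>With \<open>l\<close> the indicator of the leaves, A maps the centre to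
    \<open>l\<close> and \<open>l\<close> to three times the centre. Hence
    \<open>s *s axis c 1 + l\<close> and \<open>s *s axis c 1 - l\<close> are eigenvectors for
    \<open>s\<close> and \<open>- s\<close>, where \<open>s\<close> is the square root of 3.\<close>
  define l :: "complex^'n" where "l = (\<chi> v. if v = c then 0 else 1)"
  define s :: complex where "s = of_real (sqrt 3)"
  define \<tau> where "\<tau> = 2 * pi / (3 * sqrt 3)"
  define U where "U = transition_matrix A \<tau>"
  have s: "s * s = 3" "s \<noteq> 0"
    by (simp_all add: s_def flip: of_real_mult)
  have Ae: "A *v axis v 1 = (if v = c then l else axis c 1)" for v
    unfolding matrix_vector_mult_axis by (auto simp: vec_eq_iff column_def A l_def axis_def)
  have "(\<Sum>v\<in>UNIV. l $ v) = of_nat (card (UNIV - {c}))"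
    by (simp add: l_def sum.If_cases Compl_eq_Diff_UNIV if_distrib)
  then have l_sum: "(\<Sum>v\<in>UNIV. l $ v) = 3"
    by (simp add: card)
  have Al: "A *v l = 3 *s axis c 1"
  proof -
    have "(A *v l) $ u = 3 * axis c 1 $ u" for u
    proof (cases "u = c")
      case True
      then have "(A *v l) $ u = (\<Sum>v\<in>UNIV. l $ v)"
        unfolding matrix_vector_mult_def by (auto intro!: sum.cong simp: A l_def)
      with True l_sum show ?thesis by simp
    next
      case False
      then have "(A *v l) $ u = 0"
        unfolding matrix_vector_mult_def by (auto intro!: sum.neutral simp: A l_def)
      with False show ?thesis by (simp add: axis_def)
    qed
    then show ?thesis by (simp add: vec_eq_iff)
  qed
  \<comment> \<open>At this time the two nonzero eigenvalues yield the primitive cube roots of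
    unity.\<close>
  have exps: "exp (\<i> * of_real \<tau> * s) = (-1 + \<i> * s) / 2" "exp (\<i> * of_real \<tau> * - s) = (-1 - \<i> * s) / 2"
  proof -
    have "\<tau> * sqrt 3 = 2 * pi / 3"
      by (simp add: \<tau>_def)
    then have "sin (\<tau> * sqrt 3) = sqrt 3 / 2" "cos (\<tau> * sqrt 3) = - (1/2)"
      by (simp_all only: sin_120 cos_120)
    then show "exp (\<i> * of_real \<tau> * s) = (-1 + \<i> * s) / 2" "exp (\<i> * of_real \<tau> * - s) = (-1 - \<i> * s) / 2"
      by (simp_all add: complex_eq_iff s_def Re_exp Im_exp)
  qed
  have e1: "U *v (s *s axis c 1 + l) = ((-1 + \<i> * s) / 2) *s (s *s axis c 1 + l)"
    unfolding U_def exps(1)[symmetric]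
    by (rule transition_matrix_eigenvector)
      (simp add: matrix_vector_right_distrib vector_scalar_commute Ae Al
        vec.scale_right_distrib vector_smult_assoc s(1) add.commute)
  have e2: "U *v (s *s axis c 1 - l) = ((-1 - \<i> * s) / 2) *s (s *s axis c 1 - l)"
    unfolding U_def exps(2)[symmetric]
    by (rule transition_matrix_eigenvector)
      (simp add: matrix_vector_mult_diff_distrib vector_scalar_commute Ae Al
        vec.scale_right_diff_distrib vector_smult_assoc s(1))
  \<comment> \<open>This vector vanishes at \<open>c\<close> and its entries sum to zero over the
    three leaves, so it lies in the kernel of A.\<close>
  have e3: "U *v (3 *s axis a 1 - l) = 3 *s axis a 1 - l" if "a \<noteq> c" for a
  proof -
    have "A *v (3 *s axis a 1 - l) = 0 *s (3 *s axis a 1 - l)"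
      using that by (simp add: matrix_vector_mult_diff_distrib vector_scalar_commute Ae Al)
    from transition_matrix_eigenvector[OF this, of \<tau>] show ?thesis
      by (simp add: U_def)
  qed
  \<comment> \<open>Adding and subtracting \<open>e1\<close> and \<open>e2\<close> isolates column
    \<open>c\<close> of U and the image of \<open>l\<close>. The column of a leaf then follows from
    \<open>e3\<close>.\<close>
  have col_c: "U $ v $ c = (if v = c then - (1/2) else \<i>/2)"
    and Ul: "(U *v l) $ v = (if v = c then 3 * \<i> / 2 else - (1/2))" for v
  proof -
    have "s * U $ v $ c + (U *v l) $ v = ((-1 + \<i> * s) / 2) * (s *s axis c 1 + l) $ v"
      "s * U $ v $ c - (U *v l) $ v = ((-1 - \<i> * s) / 2) * (s *s axis c 1 - l) $ v"
      using arg_cong[OF e1, of "\<lambda>x. x $ v"] arg_cong[OF e2, of "\<lambda>x. x $ v"]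
      by (simp_all add: matrix_vector_right_distrib matrix_vector_mult_diff_distrib
          vector_scalar_commute matrix_vector_mult_axis column_def distrib_left right_diff_distrib)
    note eqs = this
    have 1: "2 * (s * U $ v $ c) = ((-1 + \<i> * s) / 2) * (s *s axis c 1 + l) $ v + ((-1 - \<i> * s) / 2) * (s *s axis c 1 - l) $ v"
      unfolding eqs[symmetric] by simp
    have 2: "2 * (U *v l) $ v = ((-1 + \<i> * s) / 2) * (s *s axis c 1 + l) $ v - ((-1 - \<i> * s) / 2) * (s *s axis c 1 - l) $ v"
      unfolding eqs[symmetric] by simp
    have "2 * (s * U $ v $ c) = 2 * (s * (if v = c then - (1/2) else \<i>/2))"
      unfolding 1 by (simp add: l_def axis_def field_simps)
    with s(2) show "U $ v $ c = (if v = c then - (1/2) else \<i>/2)"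
      by (simp only: mult_cancel_left) simp
    have "2 * (U *v l) $ v = 2 * (if v = c then 3 * \<i> / 2 else - (1/2))"
      unfolding 2 using s(1) by (simp add: l_def axis_def field_simps)
    then show "(U *v l) $ v = (if v = c then 3 * \<i> / 2 else - (1/2))"
      by (simp only: mult_cancel_left) simp
  qed
  have col: "U $ v $ a = (if v = c then \<i>/2 else if v = a then 1/2 else - (1/2))" if "a \<noteq> c" for v a
  proof -
    have "3 * U $ v $ a - (U *v l) $ v = (3 *s axis a 1 - l) $ v"
      using arg_cong[OF e3[OF that], of "\<lambda>x. x $ v"]
      by (simp add: matrix_vector_mult_diff_distrib
          vector_scalar_commute matrix_vector_mult_axis column_def)
    then have "3 * U $ v $ a = (U *v l) $ v + (3 *s axis a 1 - l) $ v"
      by (simp add: algebra_simps)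
    then have "3 * U $ v $ a = 3 * (if v = c then \<i>/2 else if v = a then 1/2 else - (1/2))"
      using that unfolding Ul by (auto simp: l_def axis_def)
    then show ?thesis by (simp only: mult_cancel_left) simp
  qed
  have "norm (U $ v $ u) = 1/2" for u v
    by (cases "u = c") (simp_all add: col_c col norm_divide)
  then have "(U *v axis u 1) * (conj_matrix U *v axis u 1) - (1 / real CARD('n)) *\<^sub>R 1 = 0" for u
    unfolding vec_eq_iff mixing_entry by (simp only: card) (simp add: power2_eq_square)
  \<comment> \<open>The deviation from uniformity is exactly zero, so the one time \<tau> serves
    every \<epsilon>.\<close>
  then show ?thesis
    unfolding eps_uniform_mixing_def U_def by (metis norm_zero)
qed

section \<open>Trees without vertices of degree two\<close>

text \<open>Paths are handled as vertex lists, but \<open>cycle\<close> speaks of arc lists; this is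
  the passage from the former to the latter.\<close>

lemma (in wf_digraph) vwalk_imp_awalk:
  assumes "vwalk p G"
  shows "\<exists>q. awalk (hd p) q (last p) \<and> awalk_verts (hd p) q = p"
  using assms
proof (induction p rule: vwalk_induct)
  case (Base u)
  then show ?case by (intro exI[of _ "[]"]) (simp add: awalk_Nil_iff)
next
  case (Cons u v es)
  then obtain e q where "e \<in> arcs G" "tail G e = u" "head G e = v"
    "awalk v q (last (v # es))" "awalk_verts v q = v # es"
    by auto
  then show ?case
    by (intro exI[of _ "e # q"]) (simp add: awalk_Cons_iff)
qed

lemma (in wf_digraph) vpath_closing_cycle:
  assumes "vpath p G" "3 \<le> length p" "last p \<rightarrow> hd p"
  shows "\<exists>c. cycle c \<and> 3 \<le> length c"
proof -
  obtain q where q: "awalk (hd p) q (last p)" "awalk_verts (hd p) q = p"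
    using assms(1) vwalk_imp_awalk by blast
  obtain e where e: "e \<in> arcs G" "tail G e = last p" "head G e = hd p"
    using assms(3) by blast
  \<comment> \<open>The closing arc goes in front, so the closed walk visits
    \<open>last p # p\<close>. Dropping its first vertex leaves the distinct list \<open>p\<close>,
    and the cycle has as many arcs as \<open>p\<close> has vertices.\<close>
  have "cycle (e # q)"
    unfolding cycle_def using q e assms(1) by (intro exI[of _ "last p"]) (auto simp: awalk_Cons_iff)
  moreover have "length p = Suc (length q)"
    using q(2) length_awalk_verts[of "hd p" q] by simp
  ultimately show ?thesis
    using assms(2) by (intro exI[of _ "e # q"]) simp
qed

text \<open>An arc from \<open>x\<close> to a vertex \<open>z\<close> beyond \<open>y\<close> would
  close the segment from \<open>x\<close> to \<open>z\<close>, which has at least three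
  vertices.\<close>

lemma (in graph) acyclic_vpath_no_chord:
  assumes acyclic: "\<not> (\<exists>c. cycle c \<and> 3 \<le> length c)"
    and path: "vpath (x # y # p) G" and "z \<in> set p"
  shows "\<not> x \<rightarrow> z"
proof
  assume "x \<rightarrow> z"
  then have "z \<rightarrow> x"
    by (rule arcs_ends_symmetric[OF sym_arcs])
  obtain p1 p2 where p: "p = p1 @ z # p2"
    using \<open>z \<in> set p\<close> by (meson split_list)
  have "vwalk (x # y # p1 @ [z]) G"
    by (rule vwalkI_append_l[of _ p2]) (use path p in \<open>simp_all add: vpath_def\<close>)
  then have "vpath (x # y # p1 @ [z]) G"
    using path p by (simp add: vpath_def)
  from vpath_closing_cycle[OF this] \<open>z \<rightarrow> x\<close> acyclic show False
    by simp
qed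

lemma (in fin_digraph) longest_vpath:
  assumes "verts G \<noteq> {}"
  obtains p where "vpath p G" "\<And>q. vpath q G \<Longrightarrow> length q \<le> length p"
proof -
  obtain u where "u \<in> verts G"
    using assms by blast
  then have "vpath [u] G"
    by (rule vpath_self)
  moreover have "length q < Suc (card (verts G))" if "vpath q G" for q
    unfolding less_Suc_eq_le using that by (metis card_mono distinct_card finite_verts vpathE vwalkE)
  ultimately have "\<exists>p. vpath p G \<and> (\<forall>q. vpath q G \<longrightarrow> length q \<le> length p)"
    by (intro ex_has_greatest_nat[where b = "Suc (card (verts G))"]) auto
  with that show thesis by blast
qed

text \<open>A neighbour off the path could be put in front of it, giving a longer path; a neighbour
  further along than the second vertex would be a chord. So an end of a longest path has at most one
  neighbour.\<close>

lemma (in graph) longest_vpath_hd_neighbour: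
  assumes acyclic: "\<not> (\<exists>c. cycle c \<and> 3 \<le> length c)"
    and path: "vpath (x # p) G" and longest: "\<And>q. vpath q G \<Longrightarrow> length q \<le> length (x # p)"
    and "x \<rightarrow> z"
  shows "p \<noteq> [] \<and> z = hd p"
proof (rule ccontr)
  assume contr: "\<not> (p \<noteq> [] \<and> z = hd p)"
  have "z \<noteq> x" "z \<rightarrow> x"
    using \<open>x \<rightarrow> z\<close> adj_not_same arcs_ends_symmetric[OF sym_arcs] by blast+
  show False
  proof (cases "z \<in> set p")
    case True
    with contr obtain y p' where "p = y # p'" "z \<in> set p'"
      by (cases p) auto
    with acyclic_vpath_no_chord[OF acyclic] path \<open>x \<rightarrow> z\<close> show False by blast
  next
    case False
    with path \<open>z \<noteq> x\<close> \<open>z \<rightarrow> x\<close> have "vpath (z # x # p) G"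
      by (intro vpathI vwalk_wf_digraph_consI[of "x # p"]) auto
    from longest[OF this] show False by simp
  qed
qed

text \<open>Connectedness refers to the symmetric closure, but arcs are already symmetric here, so
  every vertex is reachable from \<open>x\<close> in the graph itself and the closed set
  \<open>S\<close> is never left.\<close>

lemma (in graph) connected_closed_eq_verts:
  assumes "connected G" "x \<in> S" "x \<in> verts G" and closed: "\<And>u v. u \<in> S \<Longrightarrow> u \<rightarrow> v \<Longrightarrow> v \<in> S"
  shows "verts G \<subseteq> S"
proof
  fix y assume "y \<in> verts G"
  with assms(1,3) have "x \<rightarrow>\<^sup>* y"
    unfolding connected_def using reachable_mk_symmetric_eq[OF sym_arcs]
    by (auto simp: strongly_connected_def)
  then show "y \<in> S"
    by (induction rule: reachable_induct) (use assms in auto)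
qed

text \<open>Without parallel arcs, an arc leaving \<open>v\<close> is determined by its
  head.\<close>

lemma (in nomulti_digraph) out_degree_eq_card_neighbours:
  "out_degree G v = card {w. v \<rightarrow> w}"
proof -
  have "{w. v \<rightarrow> w} = head G ` out_arcs G v"
    by (auto simp: arcs_ends_conv out_arcs_def)
  moreover have "inj_on (head G) (out_arcs G v)"
    by (auto intro!: inj_onI no_multi_arcs simp: out_arcs_def arc_to_ends_def)
  ultimately show ?thesis
    by (simp add: out_degree_def card_image)
qed

text \<open>
  The first vertex of a longest path is a leaf. Its neighbour has degree at least three, hence a
  neighbour off the path; exchanging the first vertex for it yields another longest path, so it is
  a leaf as well.
\<close>

lemma (in graph) tree_twin_leaves:
  assumes conn: "connected G" and acyclic: "\<not> (\<exists>c. cycle c \<and> 3 \<le> length c)"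
    and card: "3 \<le> card (verts G)" and deg: "\<And>v. v \<in> verts G \<Longrightarrow> out_degree G v \<noteq> 2"
  obtains u v c where "u \<noteq> v" "{w. u \<rightarrow> w} = {c}" "{w. v \<rightarrow> w} = {c}" "3 \<le> card {w. c \<rightarrow> w}"
proof -
  note sym = arcs_ends_symmetric[OF sym_arcs]
  have "verts G \<noteq> {}"
    using card by auto
  from longest_vpath[OF this] obtain xp where
    xp: "vpath xp G" "\<And>q. vpath q G \<Longrightarrow> length q \<le> length xp"
    by blast
  then obtain x p where "xp = x # p"
    by (cases xp) auto
  note path = xp[unfolded this]
  have x: "x \<in> verts G"
    using path(1) by (simp add: vpath_def vwalk_def)
  note nb_x = longest_vpath_hd_neighbour[OF acyclic path]
  have "p \<noteq> []"
  proof
    assume "p = []"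
    with nb_x have "\<not> x \<rightarrow> z" for z by blast
    then have "verts G \<subseteq> {x}"
      by (intro connected_closed_eq_verts[OF conn _ x]) auto
    from card_mono[OF _ this] card show False by simp
  qed
  then obtain y r where p: "p = y # r"
    by (cases p) auto
  have "x \<rightarrow> y"
    using path(1) p by (auto simp: vwalk_def)
  then have y: "y \<in> verts G"
    by (rule adj_in_verts)
  have "w = y" if "x \<rightarrow> w" for w
    using nb_x[OF _ that] p by simp
  with \<open>x \<rightarrow> y\<close> have N_x: "{w. x \<rightarrow> w} = {y}" by blast
  have x_N_y: "x \<in> {w. y \<rightarrow> w}"
    using \<open>x \<rightarrow> y\<close> sym by blast
  have fin: "finite {w. y \<rightarrow> w}"
    by (rule finite_subset[OF _ finite_verts]) (auto dest: adj_in_verts)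
  have "card {w. y \<rightarrow> w} \<noteq> 0"
    using fin x_N_y by auto
  \<comment> \<open>If \<open>x\<close> were the only neighbour of \<open>y\<close>, the two
    vertices would form a whole component, contradicting that there are at least three
    vertices.\<close>
  moreover have "card {w. y \<rightarrow> w} \<noteq> 1"
  proof
    assume "card {w. y \<rightarrow> w} = 1"
    with x_N_y have N_y: "{w. y \<rightarrow> w} = {x}"
      by (metis card_1_singletonE singletonD)
    have "verts G \<subseteq> {x, y}"
      by (rule connected_closed_eq_verts[OF conn _ x]) (use N_x N_y in auto)
    from card_mono[OF _ this] have "card (verts G) \<le> card {x, y}" by simp
    also have "\<dots> \<le> 2" by (simp add: card_insert_if)
    finally show False using card by simp
  qed
  moreover have "card {w. y \<rightarrow> w} \<noteq> 2"
    using deg[OF y] by (simp add: out_degree_eq_card_neighbours)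
  ultimately have card_y: "3 \<le> card {w. y \<rightarrow> w}" by linarith
  \<comment> \<open>For empty \<open>r\<close> the value of \<open>hd r\<close> is unspecified,
    which does no harm: the set on the right has at most two elements in any case.\<close>
  have "\<not> {w. y \<rightarrow> w} \<subseteq> {x, hd r}"
  proof
    assume "{w. y \<rightarrow> w} \<subseteq> {x, hd r}"
    from card_mono[OF _ this] have "card {w. y \<rightarrow> w} \<le> card {x, hd r}" by simp
    also have "\<dots> \<le> 2" by (simp add: card_insert_if)
    finally show False using card_y by simp
  qed
  then obtain w where w: "y \<rightarrow> w" "w \<noteq> x" "w \<noteq> hd r" by blast
  have path_y: "vpath (y # r) G"
    using path(1) vwalkI_append_r[of "y # r" "[x]" G] unfolding p by (auto simp: vpath_def)
  have "w \<notin> set r"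
  proof
    assume "w \<in> set r"
    with w(3) obtain z r' where "r = z # r'" "w \<in> set r'"
      by (cases r) auto
    with acyclic_vpath_no_chord[OF acyclic] path_y w(1) show False by blast
  qed
  moreover have "w \<noteq> y" "w \<rightarrow> y"
    using w(1) sym adj_not_same by blast+
  ultimately have "vpath (w # y # r) G"
    using path_y by (intro vpathI vwalk_wf_digraph_consI[of "y # r"]) auto
  moreover have "length q \<le> length (w # y # r)" if "vpath q G" for q
    using path(2)[OF that] p by simp
  ultimately have "z = y" if "w \<rightarrow> z" for z
    using longest_vpath_hd_neighbour[OF acyclic _ _ that, of "y # r"] by simp
  with \<open>w \<rightarrow> y\<close> have "{z. w \<rightarrow> z} = {y}" by blast
  then show thesis
    using w(2) N_x card_y by (intro that[of x w y]) simp_all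
qed

section \<open>The star with three leaves\<close>

text \<open>Along a walk every second vertex is \<open>c\<close>. A closed walk of three arcs
  violates this by parity. With four or more arcs, the heads of the first four arcs all occur in the
  list required to be distinct, and two of them are \<open>c\<close>.\<close>

lemma star_no_long_cycle:
  assumes "wf_digraph G" and star: "\<And>u v. u \<rightarrow>\<^bsub>G\<^esub> v \<Longrightarrow> (u = c) \<noteq> (v = c)"
  shows "\<not> (\<exists>p. pre_digraph.cycle G p \<and> 3 \<le> length p)"
proof
  interpret wf_digraph G by fact
  have arc: "(tail G e = c) \<noteq> (head G e = c)" if "e \<in> arcs G" for e
    using star that by (simp add: in_arcs_imp_in_arcs_ends)
  assume "\<exists>p. cycle p \<and> 3 \<le> length p"
  then obtain u p where p: "awalk u p u" "distinct (tl (awalk_verts u p))" "3 \<le> length p"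
    unfolding cycle_def by blast
  then obtain e1 e2 e3 q where q: "p = e1 # e2 # e3 # q"
    by (auto simp: numeral_3_eq_3 Suc_le_length_iff)
  note arcs = arc[of e1] arc[of e2] arc[of e3]
  show False
  proof (cases q)
    case Nil
    with p(1) q have "e1 \<in> arcs G" "e2 \<in> arcs G" "e3 \<in> arcs G"
      "tail G e2 = head G e1" "tail G e3 = head G e2" "head G e3 = tail G e1"
      by (simp_all add: awalk_Cons_iff awalk_Nil_iff)
    with arcs show False by metis
  next
    case (Cons e4 q')
    with p(1) q have e: "e2 \<in> arcs G" "e3 \<in> arcs G" "e4 \<in> arcs G"
      "tail G e3 = head G e2" "tail G e4 = head G e3"
      and q': "tail G e2 = head G e1" "awalk (head G e4) q' u"
      by (auto simp: awalk_Cons_iff)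
    have "head G e4 \<in> set (awalk_verts (head G e4) q')"
      using q'(2) by (cases q') (auto simp: awalk_Cons_iff)
    with p(2) q Cons have "tail G e2 \<noteq> tail G e4" "head G e2 \<noteq> head G e4"
      using e(4,5) q'(1) by auto
    with e show False
      using arcs arc[of e4] by metis
  qed
qed

text \<open>The lower bound on \<open>CARD('v)\<close> sets aside the trees on one and two vertices,
  which have no vertex of degree two and do admit uniform mixing.\<close>

theorem corollary28:
  fixes G :: "('v::finite, 'e) pre_digraph"
  assumes "verts G = UNIV" and "CARD('v) \<ge> 3"
  shows "(undirected_tree G \<and> (\<forall>v\<in>verts G. out_degree G v \<noteq> 2) \<and>
            eps_uniform_mixing (adjacency_matrix G))
         \<longleftrightarrow> K\<^bsub>1,3\<^esub> G"
proof
  assume L: "undirected_tree G \<and> (\<forall>v\<in>verts G. out_degree G v \<noteq> 2) \<and>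
            eps_uniform_mixing (adjacency_matrix G)"
  then interpret graph G
    by (simp add: undirected_tree_def)
  note sym = arcs_ends_symmetric[OF sym_arcs]
  from L assms obtain u v c where uv: "u \<noteq> v" "{w. u \<rightarrow>\<^bsub>G\<^esub> w} = {c}" "{w. v \<rightarrow>\<^bsub>G\<^esub> w} = {c}"
    and deg_c: "3 \<le> card {w. c \<rightarrow>\<^bsub>G\<^esub> w}"
    using tree_twin_leaves unfolding undirected_tree_def by metis
  have u_iff: "u \<rightarrow>\<^bsub>G\<^esub> w \<longleftrightarrow> w = c" and v_iff: "v \<rightarrow>\<^bsub>G\<^esub> w \<longleftrightarrow> w = c" for w
    using uv by auto
  have "w \<rightarrow>\<^bsub>G\<^esub> u \<longleftrightarrow> w \<rightarrow>\<^bsub>G\<^esub> v" for w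
    using u_iff v_iff sym by blast
  then have card_le: "CARD('v) \<le> 4"
    using L uv(1) by (intro eps_uniform_mixing_twins_card_le_4[of "adjacency_matrix G" u v])
      (simp_all add: adjacency_matrix_def)
  have "c \<notin> {w. c \<rightarrow>\<^bsub>G\<^esub> w}"
    using adj_not_same by blast
  then have card_insert: "card (insert c {w. c \<rightarrow>\<^bsub>G\<^esub> w}) = Suc (card {w. c \<rightarrow>\<^bsub>G\<^esub> w})"
    by simp
  \<comment> \<open>The closed neighbourhood of \<open>c\<close> has at least four elements among at
    most four vertices, so it is everything and \<open>c\<close> has exactly three
    neighbours.\<close>
  have "card (insert c {w. c \<rightarrow>\<^bsub>G\<^esub> w}) \<le> CARD('v)"
    by (rule card_mono) auto
  with card_le card_insert have "card (insert c {w. c \<rightarrow>\<^bsub>G\<^esub> w}) = CARD('v)" and N3: "card {w. c \<rightarrow>\<^bsub>G\<^esub> w} = 3"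
    using deg_c by linarith+
  then have N: "insert c {w. c \<rightarrow>\<^bsub>G\<^esub> w} = UNIV"
    by (intro card_subset_eq) auto
  have uv_N: "{u, v} \<subseteq> {w. c \<rightarrow>\<^bsub>G\<^esub> w}"
    using uv sym by blast
  then have "card ({w. c \<rightarrow>\<^bsub>G\<^esub> w} - {u, v}) = 1"
    using N3 uv(1) by (simp add: card_Diff_subset)
  then obtain z where z: "{w. c \<rightarrow>\<^bsub>G\<^esub> w} - {u, v} = {z}"
    by (rule card_1_singletonE)
  have rest: "a = c \<or> a = u \<or> a = v \<or> a = z" for a
    using N z by blast
  have "arcs_ends G = {c} \<times> {w. c \<rightarrow>\<^bsub>G\<^esub> w} \<union> {w. c \<rightarrow>\<^bsub>G\<^esub> w} \<times> {c}"
  proof (intro equalityI subrelI)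
    fix a b assume ab: "a \<rightarrow>\<^bsub>G\<^esub> b"
    then have ba: "b \<rightarrow>\<^bsub>G\<^esub> a" by (rule sym)
    \<comment> \<open>The leaves \<open>u\<close> and \<open>v\<close> are adjacent only to
      \<open>c\<close>, so an arc avoiding \<open>c\<close> would have to be a loop at the remaining
      vertex \<open>z\<close>.\<close>
    have "a = c \<or> b = c"
    proof (rule ccontr)
      assume "\<not> (a = c \<or> b = c)"
      with ab ba u_iff v_iff have "a = z" "b = z"
        using rest[of a] rest[of b] by blast+
      with ab show False using adj_not_same by blast
    qed
    with ab ba show "(a, b) \<in> {c} \<times> {w. c \<rightarrow>\<^bsub>G\<^esub> w} \<union> {w. c \<rightarrow>\<^bsub>G\<^esub> w} \<times> {c}" by auto
  next
    fix a b assume "(a, b) \<in> {c} \<times> {w. c \<rightarrow>\<^bsub>G\<^esub> w} \<union> {w. c \<rightarrow>\<^bsub>G\<^esub> w} \<times> {c}"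
    then have "a \<rightarrow>\<^bsub>G\<^esub> b \<or> b \<rightarrow>\<^bsub>G\<^esub> a" by auto
    then show "a \<rightarrow>\<^bsub>G\<^esub> b" using sym[of b a] by blast
  qed
  moreover have "verts G = {c} \<union> {w. c \<rightarrow>\<^bsub>G\<^esub> w}" "{c} \<inter> {w. c \<rightarrow>\<^bsub>G\<^esub> w} = {}" "card {c} = 1"
    using N assms(1) \<open>c \<notin> _\<close> by simp_all
  ultimately show "K\<^bsub>1,3\<^esub> G"
    unfolding complete_bipartite_digraph_def using graph_axioms N3 by blast
next
  assume "K\<^bsub>1,3\<^esub> G"
  then obtain U V where "graph G" and UV: "U \<union> V = UNIV" "U \<inter> V = {}" "card U = 1" "card V = 3"
    "arcs_ends G = U \<times> V \<union> V \<times> U"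
    unfolding complete_bipartite_digraph_def assms(1) by metis
  interpret graph G by fact
  obtain c where U: "U = {c}"
    using UV(3) by (rule card_1_singletonE)
  have V: "V = - {c}"
    using compl_unique[of U V] UV(1,2) U by simp
  have arc_iff: "u \<rightarrow>\<^bsub>G\<^esub> v \<longleftrightarrow> (u = c) \<noteq> (v = c)" for u v
    unfolding UV(5) U V by auto
  have "CARD('v) = card U + card V"
    using card_Un_disjoint[of U V] UV(1,2) by simp
  then have "CARD('v) = 4"
    using UV(3,4) by simp
  then have "eps_uniform_mixing (adjacency_matrix G)"
    by (rule star_eps_uniform_mixing[where c = c]) (simp add: adjacency_matrix_def arc_iff)
  moreover have "connected G"
    unfolding connected_def
  proof (rule strongly_connectedI)
    fix u v
    have "u \<rightarrow>\<^sup>*\<^bsub>G\<^esub> c" "c \<rightarrow>\<^sup>*\<^bsub>G\<^esub> v"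
      using arc_iff[of u c] arc_iff[of c v] assms(1) by (cases "u = c"; cases "v = c"; simp)+
    then show "u \<rightarrow>\<^sup>*\<^bsub>with_proj (mk_symmetric G)\<^esub> v"
      unfolding reachable_mk_symmetric_eq[OF sym_arcs] by (rule reachable_trans)
  qed (simp add: assms(1))
  moreover have "out_degree G v \<noteq> 2" for v
  proof -
    have "{w. v \<rightarrow>\<^bsub>G\<^esub> w} = (if v = c then V else {c})"
      by (auto simp: arc_iff V)
    then show ?thesis
      using UV(4) by (simp add: out_degree_eq_card_neighbours)
  qed
  moreover have "\<not> (\<exists>p. cycle p \<and> 3 \<le> length p)"
    by (rule star_no_long_cycle[of G c]) (auto simp: arc_iff wf_digraph_axioms)
  ultimately show "undirected_tree G \<and> (\<forall>v\<in>verts G. out_degree G v \<noteq> 2) \<and>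
            eps_uniform_mixing (adjacency_matrix G)"
    using graph_axioms by (simp add: undirected_tree_def)
qed

end
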